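(* Let $0\le q<p\le 1$. As formal power series in $x$ and $y$, $$\sum_{L=1}^\infty\sum_{n=0}^{L-1}\begin{Bmatrix}L\\ n+1\end{Bmatrix}_{p,q}x^n\frac{y^{L-1}}{(L-1)!}=\exp\left(y+x\,\frac{\exp(py)-\exp(qy)}{p-q}\right).$$
   Context: $\Omega_{L,n}$ is the set of words $\tau=(\tau_1,\dots,\tau_L)$ with letters in $\{0,1,\hat 1\}$ containing exactly one $\hat 1$, exactly $n$ letters $1$ and $L-n-1$ letters $0$. For $\tau\in\Omega_{L,n}$ with $\tau_1=\hat 1$ set $$w(\tau)=\prod_{\substack{2\le i\le L\\ \tau_i=0}}\bigl(1+p\,m_i(\tau)+q\,n_i(\tau)\bigr),$$ where $m_i(\tau)$ (resp. $n_i(\tau)$) is the number of $1$'s among $\tau_2,\dots,\tau_{i-1}$ (resp. among $\tau_{i+1},\dots,\tau_L$). The restricted partition function is $$\begin{Bmatrix}L\\ n+1\end{Bmatrix}_{p,q}=\sum_{\tau\in\Omega_{L,n},\ \tau_1=\hat 1}w(\tau)\qquad(0\le n\le L-1).$$ *)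

theory Defs
  imports Complex_Main "HOL-Computational_Algebra.Formal_Power_Series"
begin

datatype letter = Zero | One | Hat

text \<open>Words are lists; the letters are numbered from 1 as on paper.\<close>

definition letter_at :: "letter list \<Rightarrow> nat \<Rightarrow> letter" where
  "letter_at \<tau> i = \<tau> ! (i - 1)"

text \<open>The last conjunct says that there are \<open>L - n - 1\<close> letters \<open>Zero\<close>, avoiding truncated
  subtraction; the set is empty unless \<open>n + 1 \<le> L\<close>.\<close>

definition \<Omega> :: "nat \<Rightarrow> nat \<Rightarrow> letter list set" where
  "\<Omega> L n = {\<tau>. length \<tau> = L \<and> count_list \<tau> Hat = 1 \<and> count_list \<tau> One = n
                 \<and> count_list \<tau> Zero + n + 1 = L}"

definition ones_left :: "letter list \<Rightarrow> nat \<Rightarrow> nat" where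
  "ones_left \<tau> i = card {j. 2 \<le> j \<and> j < i \<and> letter_at \<tau> j = One}"

definition ones_right :: "letter list \<Rightarrow> nat \<Rightarrow> nat" where
  "ones_right \<tau> i = card {j. i < j \<and> j \<le> length \<tau> \<and> letter_at \<tau> j = One}"

definition weight :: "real \<Rightarrow> real \<Rightarrow> letter list \<Rightarrow> real" where
  "weight p q \<tau> = (\<Prod>i\<in>{i. 2 \<le> i \<and> i \<le> length \<tau> \<and> letter_at \<tau> i = Zero}.
                     1 + p * real (ones_left \<tau> i) + q * real (ones_right \<tau> i))"

text \<open>\<open>restricted_pf p q L k\<close> is the bracket with upper entry \<open>L\<close> and lower entry \<open>k = n + 1\<close>;
  only \<open>1 \<le> k \<le> L\<close> is meaningful.\<close>

definition restricted_pf :: "real \<Rightarrow> real \<Rightarrow> nat \<Rightarrow> nat \<Rightarrow> real" where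
  "restricted_pf p q L k = (\<Sum>\<tau>\<in>{\<tau> \<in> \<Omega> L (k - 1). letter_at \<tau> 1 = Hat}. weight p q \<tau>)"

text \<open>Formal power series in \<open>x\<close> and \<open>y\<close> are series in \<open>y\<close> (the outer variable) whose
  coefficients are series in \<open>x\<close>.\<close>

type_synonym fps2 = "real fps fps"

definition cst :: "real \<Rightarrow> fps2" where
  "cst c = fps_const (fps_const c)"

definition X :: fps2 where
  "X = fps_const fps_X"

definition Y :: fps2 where
  "Y = fps_X"

text \<open>The series \<open>\<Sum>k. g ^ k / k!\<close>, for \<open>g\<close> without term of degree 0 in \<open>y\<close>. The library's
  \<^const>\<open>fps_exp\<close> needs coefficients in a field, so its real coefficients are embedded into
  the coefficient ring before composing.\<close>

definition exp2 :: "fps2 \<Rightarrow> fps2" where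
  "exp2 g = fps_compose (Abs_fps (\<lambda>k. fps_const (fps_nth (fps_exp 1) k))) g"

end

theory Submission
  imports Defs
begin

text \<open>The ones of a word with \<open>n\<close> ones cut it into gaps, and a zero in the gap after the
  \<open>j\<close>-th one has weight \<open>(1 + q n) + (p - q) j\<close>, which is affine in \<open>j\<close>. Removing the last letter
  shows that words with \<open>k\<close> ones and zeros of weight \<open>c + d j\<close> have an exponential generating
  function \<open>F\<^sub>k\<close> with \<open>F\<^sub>k' = (c + d k) F\<^sub>k + F\<^sub>k\<^sub>-\<^sub>1\<close>; hence
  \<open>F\<^sub>k = e\<^bsup>cy\<^esup> ((e\<^bsup>dy\<^esup> - 1) / d)\<^sup>k / k!\<close>. For \<open>k = n\<close>, \<open>c = 1 + q n\<close> and \<open>d = p - q\<close> this is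
  \<open>e\<^sup>y B\<^sup>n / n!\<close> with \<open>B = (e\<^bsup>py\<^esup> - e\<^bsup>qy\<^esup>) / (p - q)\<close>, the coefficient of \<open>x\<^sup>n\<close> in
  \<open>exp (y + x B)\<close>. That last identification holds because both sides solve
  \<open>H' = (1 + x B') H\<close>, \<open>H(0) = 1\<close>.\<close>

unbundle fps_syntax

section \<open>Words in zeros and ones, weighted by the ones to the left\<close>

definition words :: "nat \<Rightarrow> nat \<Rightarrow> letter list set" where
  "words m k = {w. length w = m \<and> set w \<subseteq> {Zero, One} \<and> count_list w One = k}"

text \<open>Both \<open>c\<close> and \<open>d\<close> are parameters independent of the number of
  ones: \<open>c\<close> has to stay fixed when the last letter is removed, although it becomes
  \<open>1 + q * real n\<close> in the end.\<close>

definition affine_weight :: "real \<Rightarrow> real \<Rightarrow> letter list \<Rightarrow> real" where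
  "affine_weight c d w =
     (\<Prod>i\<in>{i. i < length w \<and> w ! i = Zero}. c + d * real (count_list (take i w) One))"

definition word_sum :: "real \<Rightarrow> real \<Rightarrow> nat \<Rightarrow> nat \<Rightarrow> real" where
  "word_sum c d m k = (\<Sum>w\<in>words m k. affine_weight c d w)"

lemma finite_words: "finite (words m k)"
  by (rule finite_subset[OF _ finite_lists_length_eq[of "{Zero, One}" m]]) (auto simp: words_def)

lemma words_0: "words 0 k = (if k = 0 then {[]} else {})"
  by (auto simp: words_def)

lemma words_Suc:
  "words (Suc m) k = (\<lambda>w. w @ [Zero]) ` words m k \<union>
     (if k = 0 then {} else (\<lambda>w. w @ [One]) ` words m (k - 1))" (is "_ = ?R")
proof
  show "words (Suc m) k \<subseteq> ?R"
  proof
    fix w assume w: "w \<in> words (Suc m) k"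
    then obtain u x where "w = u @ [x]"
      by (cases w rule: rev_cases) (auto simp: words_def)
    with w show "w \<in> ?R"
      by (cases x) (auto simp: words_def)
  qed
qed (auto simp: words_def split: if_splits)

lemma affine_weight_Nil: "affine_weight c d [] = 1"
  by (simp add: affine_weight_def)

lemma affine_weight_snoc:
  "affine_weight c d (w @ [x]) =
     (if x = Zero then c + d * real (count_list w One) else 1) * affine_weight c d w"
proof -
  let ?I = "{i. i < length w \<and> w ! i = Zero}"
  have "{i. i < length (w @ [x]) \<and> (w @ [x]) ! i = Zero} =
      (if x = Zero then insert (length w) ?I else ?I)"
    by (auto simp: nth_append less_Suc_eq)
  moreover have "(\<Prod>i\<in>?I. c + d * real (count_list (take i (w @ [x])) One)) = affine_weight c d w"
    unfolding affine_weight_def by (rule prod.cong) auto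
  ultimately show ?thesis
    by (simp add: affine_weight_def)
qed

lemma word_sum_0: "word_sum c d 0 k = (if k = 0 then 1 else 0)"
  by (simp add: word_sum_def words_0 affine_weight_Nil)

text \<open>Weights look only to the left, so the last letter never affects earlier factors: a final
  zero sees all \<open>k\<close> ones, a final one contributes the factor 1.\<close>

lemma word_sum_Suc:
  "word_sum c d (Suc m) k =
     (c + d * real k) * word_sum c d m k + (if k = 0 then 0 else word_sum c d m (k - 1))"
proof -
  have inj: "inj_on (\<lambda>w. w @ [x]) A" for x :: letter and A
    by (auto simp: inj_on_def)
  have Zero: "(\<Sum>w\<in>(\<lambda>w. w @ [Zero]) ` words m k. affine_weight c d w) =
      (c + d * real k) * word_sum c d m k"
    by (simp add: sum.reindex[OF inj] affine_weight_snoc word_sum_def sum_distrib_left)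
       (rule sum.cong, auto simp: words_def)
  have One: "(\<Sum>w\<in>(\<lambda>w. w @ [One]) ` words m j. affine_weight c d w) = word_sum c d m j" for j
    by (simp add: sum.reindex[OF inj] affine_weight_snoc word_sum_def)
  have "(\<lambda>w. w @ [Zero]) ` words m k \<inter> (\<lambda>w. w @ [One]) ` words m j = {}" for j
    by auto
  then show ?thesis
    by (simp add: word_sum_def[of c d "Suc m"] words_Suc sum.union_disjoint finite_words Zero One)
qed

lemma word_sum_eq_0: "m < k \<Longrightarrow> word_sum c d m k = 0"
  by (induction m arbitrary: k) (auto simp: word_sum_0 word_sum_Suc)

section \<open>Exponential generating functions of word sums\<close>

definition word_egf :: "real \<Rightarrow> real \<Rightarrow> nat \<Rightarrow> real fps" where
  "word_egf c d k = fps_const (1 / fact k) * fps_exp c * (fps_const (1 / d) * (fps_exp d - 1)) ^ k"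

lemma fps_deriv_word_egf:
  assumes "d \<noteq> 0"
  shows "fps_deriv (word_egf c d k) =
    fps_const (c + d * real k) * word_egf c d k + (if k = 0 then 0 else word_egf c d (k - 1))"
proof (cases k)
  case 0
  then show ?thesis by (simp add: word_egf_def)
next
  case (Suc j)
  define U where "U = fps_const (1 / d) * (fps_exp d - 1)"
  \<comment> \<open>The derivative \<open>fps_exp d\<close> is rewritten in terms of
    \<open>U\<close>, so that the derivative of \<open>U ^ k\<close> splits into multiples of
    \<open>U ^ k\<close> and \<open>U ^ j\<close>.\<close>
  have dU: "fps_deriv U = fps_const d * U + 1"
    using assms by (simp add: U_def fps_eq_iff)
  have fact: "fps_const (1 / fact k) * fps_const (real k) = fps_const (1 / fact j)"
    by (simp add: Suc fps_const_mult[symmetric] del: of_nat_Suc)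
  have dpow: "fps_deriv (U ^ k) = fps_const (real k) * (fps_const d * U + 1) * U ^ j"
    by (simp add: fps_deriv_power dU Suc del: of_nat_Suc power_Suc)
  have pow: "U ^ k = U * U ^ j"
    by (simp add: Suc)
  have "fps_deriv (word_egf c d k) =
      fps_const (c + d * real k) * (fps_const (1 / fact k) * fps_exp c * U ^ k)
      + fps_const (1 / fact k) * fps_const (real k) * fps_exp c * U ^ j"
    unfolding word_egf_def U_def[symmetric] fps_deriv_mult fps_deriv_const fps_exp_deriv dpow
    unfolding pow fps_const_add[symmetric] fps_const_mult[symmetric]
    by algebra
  then show ?thesis
    unfolding fact by (simp add: word_egf_def U_def Suc)
qed

text \<open>Read coefficientwise, the differential equation of \<open>word_egf\<close> is the
  recurrence \<open>word_sum_Suc\<close>; the initial values agree because the base of the power has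
  constant term 0.\<close>

lemma word_egf_nth:
  assumes "d \<noteq> 0"
  shows "word_egf c d k $ m = word_sum c d m k / fact m"
proof (induction m arbitrary: k)
  case 0
  show ?case by (simp add: word_egf_def word_sum_0 fps_power_zeroth)
next
  case (Suc m)
  have "real (Suc m) * word_egf c d k $ Suc m = fps_deriv (word_egf c d k) $ m"
    by simp
  also have "\<dots> = word_sum c d (Suc m) k / fact m"
    unfolding fps_deriv_word_egf[OF assms] word_sum_Suc
    by (simp add: Suc.IH add_divide_distrib)
  finally show ?case
    by (simp add: field_simps del: of_nat_Suc)
qed

section \<open>Reduction of the partition function to word sums\<close>

lemma count_list_conv_card: "count_list xs x = card {i. i < length xs \<and> xs ! i = x}"
  by (simp add: count_list_eq_length_filter length_filter_conv_card eq_commute)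

text \<open>The offset 2 combines numbering from 1 with the removal of the first letter.\<close>

lemma letter_at_Cons: "letter_at (x # w) (i + 2) = w ! i"
  by (simp add: letter_at_def)

lemma Collect_ge_conv_image:
  fixes a :: nat
  shows "{j. a \<le> j \<and> P j} = (\<lambda>j. j + a) ` {j. P (j + a)}"
  by (auto simp: image_iff) (metis le_add_diff_inverse2)

lemma card_Collect_ge:
  fixes a :: nat
  shows "card {j. a \<le> j \<and> P j} = card {j. P (j + a)}"
  by (simp add: Collect_ge_conv_image card_image inj_on_def)

lemma ones_left_Cons:
  assumes "i \<le> length w"
  shows "ones_left (x # w) (i + 2) = count_list (take i w) One"
proof -
  have "ones_left (x # w) (i + 2) = card {j. j < i \<and> w ! j = One}"
    unfolding ones_left_def card_Collect_ge letter_at_Cons by simp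
  also have "{j. j < i \<and> w ! j = One} = {j. j < length (take i w) \<and> take i w ! j = One}"
    using assms by auto
  finally show ?thesis by (simp add: count_list_conv_card)
qed

lemma ones_right_Cons:
  assumes "i < length w"
  shows "ones_right (x # w) (i + 2) = count_list (drop (Suc i) w) One"
proof -
  have "{j. i + 2 < j \<and> j \<le> length (x # w) \<and> letter_at (x # w) j = One} =
      {j. Suc i + 2 \<le> j \<and> (j \<le> length (x # w) \<and> letter_at (x # w) j = One)}"
    by auto
  then have "ones_right (x # w) (i + 2) =
      card {j. j + (Suc i + 2) \<le> length (x # w) \<and> letter_at (x # w) (j + (Suc i + 2)) = One}"
    unfolding ones_right_def by (simp only: card_Collect_ge)
  also have "\<dots> = card {j. j < length (drop (Suc i) w) \<and> drop (Suc i) w ! j = One}"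
    unfolding add.assoc[symmetric] letter_at_Cons
    using assms by (intro arg_cong[where f = card]) (auto simp: add.commute)
  finally show ?thesis by (simp add: count_list_conv_card)
qed

lemma weight_Cons:
  "weight p q (x # w) = affine_weight (1 + q * real (count_list w One)) (p - q) w"
proof -
  have "{i. 2 \<le> i \<and> i \<le> length (x # w) \<and> letter_at (x # w) i = Zero} =
      (\<lambda>i. i + 2) ` {i. i < length w \<and> w ! i = Zero}"
    unfolding Collect_ge_conv_image letter_at_Cons by (simp add: Suc_le_eq)
  then have "weight p q (x # w) = (\<Prod>i\<in>{i. i < length w \<and> w ! i = Zero}.
      1 + p * real (ones_left (x # w) (i + 2)) + q * real (ones_right (x # w) (i + 2)))"
    unfolding weight_def by (simp add: prod.reindex inj_on_def)
  also have "\<dots> = affine_weight (1 + q * real (count_list w One)) (p - q) w"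
    unfolding affine_weight_def
  proof (rule prod.cong[OF refl])
    fix i assume "i \<in> {i. i < length w \<and> w ! i = Zero}"
    then have i: "i < length w" "w ! i = Zero" by auto
    \<comment> \<open>The letter at \<open>i\<close> is a zero, so every one of \<open>w\<close>
      lies to its left or to its right. This trades the ones on the right for the total, which gives
      the slope \<open>p - q\<close>.\<close>
    have "count_list w One = count_list (take i w @ w ! i # drop (Suc i) w) One"
      using id_take_nth_drop[OF i(1)] by (rule arg_cong[where f = "\<lambda>v. count_list v One"])
    then have "count_list w One = count_list (take i w) One + count_list (drop (Suc i) w) One"
      by (simp only: i count_list_append count_list.simps letter.simps if_False)
    then show "1 + p * real (ones_left (x # w) (i + 2)) + q * real (ones_right (x # w) (i + 2)) =
        1 + q * real (count_list w One) + (p - q) * real (count_list (take i w) One)"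
      using i ones_left_Cons[of i w x] ones_right_Cons[of i w x] by (simp add: algebra_simps)
  qed
  finally show ?thesis .
qed

lemma Hat_notin_set_conv:
  "Hat \<notin> set w \<longleftrightarrow> set w \<subseteq> {Zero, One}"
  using letter.exhaust by auto

lemma count_Zero_plus_One:
  "set w \<subseteq> {Zero, One} \<Longrightarrow> count_list w Zero + count_list w One = length w"
  by (induction w) auto

text \<open>The only \<open>Hat\<close> is spent on the first position; in the rest, the length and
  the number of ones fix the number of zeros.\<close>

lemma \<Omega>_Hat_first:
  "{\<tau> \<in> \<Omega> (Suc m) n. letter_at \<tau> 1 = Hat} = (#) Hat ` words m n"
proof (intro set_eqI iffI)
  fix \<tau> assume "\<tau> \<in> {\<tau> \<in> \<Omega> (Suc m) n. letter_at \<tau> 1 = Hat}"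
  then show "\<tau> \<in> (#) Hat ` words m n"
    by (cases \<tau>) (auto simp: \<Omega>_def words_def letter_at_def count_list_0_iff
        Hat_notin_set_conv[symmetric])
next
  fix \<tau> assume "\<tau> \<in> (#) Hat ` words m n"
  then obtain w where w: "\<tau> = Hat # w" "length w = m" "set w \<subseteq> {Zero, One}" "count_list w One = n"
    by (auto simp: words_def)
  then show "\<tau> \<in> {\<tau> \<in> \<Omega> (Suc m) n. letter_at \<tau> 1 = Hat}"
    using count_Zero_plus_One[of w]
    by (auto simp: \<Omega>_def letter_at_def count_list_0_iff)
qed

lemma restricted_pf_eq_word_sum:
  "restricted_pf p q (Suc m) (Suc n) = word_sum (1 + q * real n) (p - q) m n"
  unfolding restricted_pf_def diff_Suc_1 \<Omega>_Hat_first
  by (subst sum.reindex) (auto simp: word_sum_def weight_Cons words_def intro!: sum.cong)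

section \<open>Coefficients of the exponential on the right-hand side\<close>

definition gap_series :: "real \<Rightarrow> real \<Rightarrow> real fps" where
  "gap_series p q = fps_const (1 / (p - q)) * (fps_exp p - fps_exp q)"

text \<open>\<open>gap_series p q\<close> is \<open>fps_exp q\<close> times the base of the power in
  \<open>word_egf\<close>, so its \<open>n\<close>-th power absorbs
  \<open>fps_exp (q * real n)\<close> and leaves \<open>fps_exp 1\<close>.\<close>

lemma word_egf_eq_gap_series:
  "word_egf (1 + q * real n) (p - q) n =
     fps_const (1 / fact n) * fps_exp 1 * gap_series p q ^ n"
proof -
  have "gap_series p q = fps_exp q * (fps_const (1 / (p - q)) * (fps_exp (p - q) - 1))"
    using fps_exp_add_mult[of q "p - q"] by (simp add: gap_series_def algebra_simps)
  then show ?thesis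
    by (simp add: word_egf_def power_mult_distrib fps_exp_power_mult fps_exp_add_mult mult_ac)
qed

text \<open>The prospective coefficient of \<open>x^n\<close> in \<open>exp (y + x B)\<close>,
  confirmed by \<open>exp2_nth_nth\<close> for \<open>B\<close> without constant term.\<close>

definition xseries :: "real fps \<Rightarrow> nat \<Rightarrow> real fps" where
  "xseries B n = fps_const (1 / fact n) * fps_exp 1 * B ^ n"

lemma fps_deriv_xseries:
  "fps_deriv (xseries B n) =
     xseries B n + (if n = 0 then 0 else fps_deriv B * xseries B (n - 1))"
proof (cases n)
  case 0
  then show ?thesis by (simp add: xseries_def)
next
  case (Suc j)
  have fact: "fps_const (1 / fact n) * fps_const (real n) = fps_const (1 / fact j)"
    by (simp add: Suc del: of_nat_Suc)
  have dpow: "fps_deriv (B ^ n) = fps_const (real n) * fps_deriv B * B ^ j"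
    by (simp add: fps_deriv_power Suc del: of_nat_Suc power_Suc)
  have "fps_deriv (xseries B n) =
      xseries B n + (fps_const (1 / fact n) * fps_const (real n)) * fps_deriv B * fps_exp 1 * B ^ j"
    unfolding xseries_def fps_deriv_mult fps_deriv_const fps_exp_deriv fps_const_1_eq_1 dpow
    by algebra
  then show ?thesis
    unfolding fact by (simp add: xseries_def Suc mult_ac)
qed

definition embed :: "real fps \<Rightarrow> fps2" where
  "embed f = Abs_fps (\<lambda>m. fps_const (f $ m))"

lemma exp2_cst_Y: "exp2 (cst c * Y) = embed (fps_exp c)"
  by (simp add: exp2_def cst_def Y_def embed_def fps_compose_linear fps_eq_iff fps_const_power
      flip: fps_const_mult)

text \<open>Differentiation is in \<open>y\<close>. The outer series is its own derivative, and the
  vanishing constant term permits the chain rule.\<close>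

lemma fps_deriv_exp2:
  assumes "g $ 0 = 0"
  shows "fps_deriv (exp2 g) = exp2 g * fps_deriv g"
proof -
  have "fps_deriv (Abs_fps (\<lambda>k. fps_const (fps_exp (1::real) $ k))) =
      Abs_fps (\<lambda>k. fps_const (fps_exp (1::real) $ k))"
    by (rule fps_ext) (simp add: fps_of_nat[symmetric] field_simps del: of_nat_Suc)
  then show ?thesis
    unfolding exp2_def using fps_compose_deriv[OF assms] by metis
qed

text \<open>Coefficient \<open>j\<close> of \<open>H * a\<close> involves only \<open>H $ 0\<close>
  to \<open>H $ j\<close>, so the equation determines \<open>H $ Suc j\<close>: the nonzero factor
  \<open>of_nat (Suc j)\<close> cancels in \<open>real fps\<close>.\<close>

lemma fps_linear_ode_unique:
  fixes H K a :: fps2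
  assumes "fps_deriv H = H * a" "fps_deriv K = K * a" "H $ 0 = K $ 0"
  shows "H = K"
proof (rule fps_ext)
  fix m show "H $ m = K $ m"
  proof (induction m rule: less_induct)
    case (less m)
    show ?case
    proof (cases m)
      case 0
      then show ?thesis using assms by simp
    next
      case (Suc j)
      have "(H * a) $ j = (K * a) $ j"
        unfolding fps_mult_nth by (rule sum.cong) (auto simp: less Suc)
      then have "of_nat (Suc j) * H $ Suc j = of_nat (Suc j) * K $ Suc j"
        using assms by (metis fps_deriv_nth Suc_eq_plus1)
      then show ?thesis
        unfolding Suc by (metis mult_left_cancel of_nat_neq_0)
    qed
  qed
qed

lemma exp2_nth_nth:
  assumes "B $ 0 = 0"
  shows "exp2 (Y + X * embed B) $ m $ n = xseries B n $ m"
proof -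
  \<comment> \<open>The candidate solution: the outer index is the degree in \<open>y\<close>, the
    inner one the degree in \<open>x\<close>.\<close>
  define K :: fps2 where "K = Abs_fps (\<lambda>m. Abs_fps (\<lambda>n. xseries B n $ m))"
  let ?g = "Y + X * embed B"
  have g0: "?g $ 0 = 0"
    using assms by (simp add: Y_def X_def embed_def)
  have dg: "fps_deriv ?g = 1 + X * embed (fps_deriv B)"
    by (rule fps_ext) (simp add: Y_def X_def embed_def fps_of_nat[symmetric] algebra_simps)
  have "fps_deriv K = K * fps_deriv ?g"
  proof (intro fps_ext)
    fix m n
    have "(embed (fps_deriv B) * K) $ m $ j = (fps_deriv B * xseries B j) $ m" for j
      by (simp add: fps_mult_nth[of _ _ m] embed_def K_def fps_sum_nth del: fps_deriv_nth)
    moreover have "K * fps_deriv ?g = K + X * (embed (fps_deriv B) * K)"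
      unfolding dg by (simp add: algebra_simps)
    \<comment> \<open>Multiplication by \<open>X\<close> shifts the inner index, leaving 0 at
      \<open>n = 0\<close>.\<close>
    ultimately have "(K * fps_deriv ?g) $ m $ n =
        xseries B n $ m + (if n = 0 then 0 else (fps_deriv B * xseries B (n - 1)) $ m)"
      by (simp add: X_def) (simp add: K_def)
    also have "\<dots> = fps_deriv (xseries B n) $ m"
      unfolding fps_deriv_xseries by simp
    also have "\<dots> = fps_deriv K $ m $ n"
      by (simp add: K_def fps_of_nat[symmetric] del: of_nat_Suc)
    finally show "fps_deriv K $ m $ n = (K * fps_deriv ?g) $ m $ n" ..
  qed
  \<comment> \<open>Both sides are 1, since \<open>B $ 0 = 0\<close> removes the constant term of
    \<open>xseries B n\<close> for positive \<open>n\<close>.\<close>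
  moreover have "exp2 ?g $ 0 = K $ 0"
    using assms by (intro fps_ext) (simp add: exp2_def K_def xseries_def fps_power_zeroth)
  ultimately have "exp2 ?g = K"
    by (rule fps_linear_ode_unique[OF fps_deriv_exp2[OF g0]])
  then show ?thesis by (simp add: K_def)
qed

section \<open>Assembling the double series\<close>

lemma fps_const_sum: "fps_const (\<Sum>i\<in>A. f i) = (\<Sum>i\<in>A. fps_const (f i))"
  by (rule fps_ext) (simp add: fps_sum_nth)

lemma cst_monomial:
  "cst a * X ^ n * (cst b * Y ^ l) = fps_const (fps_const (a * b) * fps_X ^ n) * fps_X ^ l"
  unfolding cst_def X_def Y_def
  by (simp only: fps_const_power fps_const_mult[symmetric] mult_ac)

lemma fps_sums_monomials: "(\<lambda>n. fps_const (a $ n) * fps_X ^ n) sums a"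
  unfolding sums_def' by (rule fps_notation)

theorem theorem2p7:
  fixes p q :: real
  assumes "0 \<le> q" and "q < p" and "p \<le> 1"
  shows "(\<lambda>l. let L = l + 1 in
            \<Sum>n = 0..L - 1. cst (restricted_pf p q L (n + 1)) * X ^ n
                             * (cst (1 / fact (L - 1)) * Y ^ (L - 1)))
         sums exp2 (Y + X * (cst (1 / (p - q)) * (exp2 (cst p * Y) - exp2 (cst q * Y))))"
proof -
  let ?B = "gap_series p q"
  have B0: "?B $ 0 = 0"
    by (simp add: gap_series_def)
  let ?H = "exp2 (Y + X * embed ?B)"
  have "cst (1 / (p - q)) * (exp2 (cst p * Y) - exp2 (cst q * Y)) = embed ?B"
    unfolding exp2_cst_Y by (rule fps_ext) (simp add: embed_def cst_def gap_series_def)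
  moreover have "(\<Sum>n = 0..l. cst (restricted_pf p q (l + 1) (n + 1)) * X ^ n
      * (cst (1 / fact l) * Y ^ l)) = fps_const (?H $ l) * fps_X ^ l" for l
  proof -
    have coeff: "?H $ l $ n = restricted_pf p q (l + 1) (n + 1) / fact l" for n
      using assms
      by (simp add: exp2_nth_nth B0 xseries_def word_egf_eq_gap_series[symmetric] word_egf_nth
          restricted_pf_eq_word_sum)
    \<comment> \<open>A word of length \<open>l\<close> has at most \<open>l\<close> ones, so
      \<open>?H $ l\<close> is a polynomial in \<open>x\<close> of degree at most \<open>l\<close>
      and equals a finite sum of monomials.\<close>
    have "?H $ l $ n = 0" if "l < n" for n
      using that by (simp add: coeff restricted_pf_eq_word_sum word_sum_eq_0)
    then have "(\<Sum>n = 0..l. fps_const (?H $ l $ n) * fps_X ^ n) = ?H $ l"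
      by (intro fps_ext) (simp add: fps_sum_rep_nth)
    then have "?H $ l =
        (\<Sum>n = 0..l. fps_const (restricted_pf p q (l + 1) (n + 1) / fact l) * fps_X ^ n)"
      unfolding coeff by (rule sym)
    then show ?thesis
      by (simp add: cst_monomial fps_const_sum sum_distrib_right)
  qed
  ultimately show ?thesis
    using fps_sums_monomials[of ?H] by (simp add: Let_def)
qed

end
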